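(* Let $N\ge 2$, $v\in\mathbb{R}^N$ with $|v|<1$, $m,a>0$, and $2+\frac{2}{N}<p\le\frac{2N}{N-1}$. Then the problem $d_p(a)=\inf_{\varphi\in\mathcal{S}_a}E_p(\varphi)$ admits no minimizer.
   Context: Functions are complex-valued on $\mathbb{R}^N$; $\|\cdot\|_q$ is the $L^q(\mathbb{R}^N)$ norm; $\hat u$ is the (unitary) Fourier transform. $H^{1/2}(\mathbb{R}^N)$ is the usual fractional Sobolev space and $W^{1/2}(\mathbb{R}^N):=\{\varphi\in H^{1/2}(\mathbb{R}^N): |\varphi|^2\log|\varphi|^2\in L^1(\mathbb{R}^N)\}$ (with $0\log 0=0$). For $m>0$ the operator $\sqrt{-\Delta+m^2}-m$ is the Fourier multiplier with symbol $\sqrt{|k|^2+m^2}-m$, and $\int\bar\varphi(\sqrt{-\Delta+m^2}-m+iv\cdot\nabla)\varphi\,dx$ is understood as the quadratic form $\int_{\mathbb{R}^N}(\sqrt{|k|^2+m^2}-m-v\cdot k)|\hat\varphi(k)|^2\,dk$ on $H^{1/2}(\mathbb{R}^N)$. For $a>0$: $\mathcal{S}_a:=\{\varphi\in W^{1/2}(\mathbb{R}^N):\|\varphi\|_2^2=a\}$, and $$E_p(\varphi):=\frac12\int_{\mathbb{R}^N}\bar\varphi(\sqrt{-\Delta+m^2}-m+iv\cdot\nabla)\varphi\,dx-\frac1p\|\varphi\|_p^p-\frac12\int_{\mathbb{R}^N}|\varphi|^2(\log|\varphi|^2-1)\,dx,\qquad d_p(a):=\inf_{\varphi\in\mathcal{S}_a}E_p(\varphi)\in[-\infty,+\infty).$$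 A minimizer is a $\varphi\in\mathcal{S}_a$ with $E_p(\varphi)=d_p(a)$. *)

theory Defs
  imports "HOL-Analysis.Analysis"
begin

text \<open>
  The space of dimension N is \<^typ>\<open>real^'n\<close>, with N = \<^term>\<open>CARD('n)\<close>. Elements of Lebesgue and Sobolev
  spaces are represented by Lebesgue measurable functions (not classes modulo null sets); all the
  notions below are invariant under modification on a null set.
\<close>

definition Lspace :: "real \<Rightarrow> (real^'n \<Rightarrow> complex) set" where
  "Lspace q = {f \<in> borel_measurable lebesgue. integrable lebesgue (\<lambda>x. norm (f x) powr q)}"

definition Lnorm :: "real \<Rightarrow> (real^'n \<Rightarrow> complex) \<Rightarrow> real" where
  "Lnorm q f = (LINT x|lebesgue. norm (f x) powr q) powr (1 / q)"

definition fourier_L1 :: "(real^'n \<Rightarrow> complex) \<Rightarrow> real^'n \<Rightarrow> complex" where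
  "fourier_L1 u k = complex_of_real ((2 * pi) powr (- real CARD('n) / 2)) *
     (LINT x|lebesgue. exp (- (\<i> * complex_of_real (k \<bullet> x))) * u x)"

text \<open>
  The unitary Fourier transform on square-integrable functions (Plancherel): the limit in the
  mean of the integrals over the balls of radius n (the truncations are integrable and converge
  to u in mean square). The limit is unique only almost everywhere, hence the choice of a
  representative. Convergence is stated with the nonnegative integral, so that it does not
  presuppose integrability of the differences.
\<close>

definition is_fourier_L2 :: "(real^'n \<Rightarrow> complex) \<Rightarrow> (real^'n \<Rightarrow> complex) \<Rightarrow> bool" where
  "is_fourier_L2 u g \<longleftrightarrow> g \<in> Lspace 2 \<and>
     (\<lambda>n. \<integral>\<^sup>+ k. ennreal ((norm (fourier_L1 (\<lambda>x. indicator (cball 0 (real n)) x * u x) k - g k))\<^sup>2) \<partial>lebesgue)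
       \<longlonglongrightarrow> 0"

definition fourier :: "(real^'n \<Rightarrow> complex) \<Rightarrow> real^'n \<Rightarrow> complex" where
  "fourier u = (SOME g. is_fourier_L2 u g)"

definition H_half :: "(real^'n \<Rightarrow> complex) set" where
  "H_half = {u \<in> Lspace 2. integrable lebesgue (\<lambda>k. sqrt (1 + (norm k)\<^sup>2) * (norm (fourier u k))\<^sup>2)}"

text \<open>The convention 0 log 0 = 0 is automatic below, as the factor in front of the logarithm vanishes.\<close>

definition W_half :: "(real^'n \<Rightarrow> complex) set" where
  "W_half = {u \<in> H_half. integrable lebesgue (\<lambda>x. (norm (u x))\<^sup>2 * ln ((norm (u x))\<^sup>2))}"

definition mass_sphere :: "real \<Rightarrow> (real^'n \<Rightarrow> complex) set" where
  "mass_sphere a = {u \<in> W_half. (Lnorm 2 u)\<^sup>2 = a}"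

definition kinetic :: "real \<Rightarrow> real^'n \<Rightarrow> (real^'n \<Rightarrow> complex) \<Rightarrow> real" where
  "kinetic m v u =
     (LINT k|lebesgue. (sqrt ((norm k)\<^sup>2 + m\<^sup>2) - m - v \<bullet> k) * (norm (fourier u k))\<^sup>2)"

text \<open>
  Real-valued: on \<^term>\<open>W_half\<close> all integrals converge absolutely, the one in the p-norm by the
  Sobolev embedding when 2 \<le> p \<le> 2N/(N-1).
\<close>

definition energy :: "real \<Rightarrow> real^'n \<Rightarrow> real \<Rightarrow> (real^'n \<Rightarrow> complex) \<Rightarrow> real" where
  "energy m v p u = 1/2 * kinetic m v u - 1/p * Lnorm p u powr p
     - 1/2 * (LINT x|lebesgue. (norm (u x))\<^sup>2 * (ln ((norm (u x))\<^sup>2) - 1))"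

definition d_inf :: "real \<Rightarrow> real^'n \<Rightarrow> real \<Rightarrow> real \<Rightarrow> ereal" where
  "d_inf m v p a = (INF u\<in>mass_sphere a. ereal (energy m v p u))"

definition is_minimizer :: "real \<Rightarrow> real^'n \<Rightarrow> real \<Rightarrow> real \<Rightarrow> (real^'n \<Rightarrow> complex) \<Rightarrow> bool" where
  "is_minimizer m v p a u \<longleftrightarrow> u \<in> mass_sphere a \<and> ereal (energy m v p u) = d_inf m v p a"

end

theory Submission
  imports Defs "HOL-Probability.Sinc_Integral" "HOL-Real_Asymp.Real_Asymp"
begin

text \<open>
  There is no minimizer because the infimum is \<open>-\<infinity>\<close>, while the energy of any single function is
  a real number. The problem is mass-supercritical: under the dilation
  \<open>u\<^sub>t(x) = t^(N/2) u(t x)\<close>, which keeps the mass, the kinetic energy is at most of order \<open>t\<close>,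
  because its symbol is bounded by \<open>2 |k|\<close>; the entropy integral changes by \<open>a N ln t\<close>; and the
  p-th power integral is multiplied by \<open>t^(N (p - 2) / 2)\<close>, where \<open>N (p - 2) / 2 > 1\<close> exactly
  when \<open>p > 2 + 2/N\<close>. As \<open>t\<close> grows, the negative p-term wins (\<open>energy_unbounded_below\<close>).

  It suffices to dilate one function, and the choice of that function removes all Plancherel and
  Sobolev theory. If \<open>u\<close> is bounded and has compact support, then the truncations in the
  definition of the Fourier transform are eventually \<open>u\<close> itself, so that the transform is, almost
  everywhere, the explicit integral \<open>fourier_L1 u\<close> as soon as the latter is square-integrable
  (\<open>is_fourier_L2_iff\<close>). All integrals over \<open>u\<close> converge trivially. What remains is one such
  \<open>u\<close> whose transform has a finite \<open>H^(1/2)\<close> norm. The product over the coordinates of the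
  truncated parabola \<open>max(0, 1 - y^2)\<close> will do: its transform is a product of one-dimensional
  transforms of size \<open>O(1 / (1 + k^2))\<close>
  (\<open>norm_parabola_transform_le\<close>, \<open>integrable_fourier_product_bump\<close>).
\<close>

section \<open>Dilations of integrals and of Fourier integrals\<close>

lemma integral_lebesgue_borel:
  fixes f :: "'a::euclidean_space \<Rightarrow> 'b::{banach, second_countable_topology}"
  assumes "f \<in> borel_measurable borel"
  shows "integral\<^sup>L lebesgue f = integral\<^sup>L lborel f"
  using assms by (intro integral_completion) simp

lemma integrable_lebesgue_borel:
  fixes f :: "'a::euclidean_space \<Rightarrow> 'b::{banach, second_countable_topology}"
  assumes "f \<in> borel_measurable borel"
  shows "integrable lebesgue f \<longleftrightarrow> integrable lborel f"
  using assms by (intro integrable_completion) simp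

lemma borel_imp_lebesgue_measurable:
  "f \<in> borel_measurable borel \<Longrightarrow> f \<in> borel_measurable lebesgue"
  by (simp add: measurable_completion)

lemma
  fixes f :: "real^'n \<Rightarrow> 'b::{banach, second_countable_topology}"
  assumes f[measurable]: "f \<in> borel_measurable borel" and t: "t > 0"
  shows integral_dilation: "(LINT x|lebesgue. f (t *\<^sub>R x)) = (1 / t ^ CARD('n)) *\<^sub>R (LINT x|lebesgue. f x)"
    and integrable_dilation: "integrable lebesgue (\<lambda>x. f (t *\<^sub>R x)) \<longleftrightarrow> integrable lebesgue f"
proof -
  let ?g = "\<lambda>x. f (t *\<^sub>R x)"
  have g[measurable]: "?g \<in> borel_measurable borel" by measurable
  have eq: "lborel = density (distr lborel borel (\<lambda>x::real^'n. t *\<^sub>R x)) (\<lambda>_. ennreal (t ^ CARD('n)))"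
    using lborel_affine[of t "0::real^'n"] t by (simp add: ennreal_power)
  have "integral\<^sup>L lborel f = integral\<^sup>L (density (distr lborel borel (\<lambda>x::real^'n. t *\<^sub>R x)) (\<lambda>_. ennreal (t ^ CARD('n)))) f"
    using eq by simp
  also have "\<dots> = (t ^ CARD('n)) *\<^sub>R (LINT x|lborel. ?g x)"
    using t by (subst integral_density) (auto simp: integral_distr)
  finally have i: "integral\<^sup>L lborel f = (t ^ CARD('n)) *\<^sub>R (LINT x|lborel. ?g x)" .
  show "(LINT x|lebesgue. f (t *\<^sub>R x)) = (1 / t ^ CARD('n)) *\<^sub>R (LINT x|lebesgue. f x)"
    unfolding integral_lebesgue_borel[OF f] integral_lebesgue_borel[OF g] i using t by simp
  have "integrable lborel f \<longleftrightarrow> integrable (density (distr lborel borel (\<lambda>x::real^'n. t *\<^sub>R x)) (\<lambda>_. ennreal (t ^ CARD('n)))) f"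
    using eq by simp
  also have "\<dots> \<longleftrightarrow> integrable lborel ?g"
    using t integrable_scaleR_right[of "inverse (t ^ CARD('n))" lborel "\<lambda>x. t ^ CARD('n) *\<^sub>R ?g x"]
    by (subst integrable_density) (auto simp: integrable_distr_eq)
  finally show "integrable lebesgue (\<lambda>x. f (t *\<^sub>R x)) \<longleftrightarrow> integrable lebesgue f"
    unfolding integrable_lebesgue_borel[OF f] integrable_lebesgue_borel[OF g] by simp
qed

lemma borel_measurable_fourier_L1:
  fixes u :: "real^'n \<Rightarrow> complex"
  assumes [measurable]: "u \<in> borel_measurable borel"
  shows "fourier_L1 u \<in> borel_measurable borel"
proof -
  have "(\<lambda>k. LINT x|lborel. exp (- (\<i> * complex_of_real (k \<bullet> x))) * u x) \<in> borel_measurable borel"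
    by (rule sigma_finite_measure.borel_measurable_lebesgue_integral) (auto intro: sigma_finite_lborel)
  moreover have "(LINT x|lebesgue. exp (- (\<i> * complex_of_real (k \<bullet> x))) * u x) =
      (LINT x|lborel. exp (- (\<i> * complex_of_real (k \<bullet> x))) * u x)" for k
    by (rule integral_lebesgue_borel) measurable
  ultimately show ?thesis
    unfolding fourier_L1_def[abs_def] by simp
qed

lemma fourier_L1_dilation:
  fixes u :: "real^'n \<Rightarrow> complex"
  assumes [measurable]: "u \<in> borel_measurable borel" and t: "t > 0"
  shows "fourier_L1 (\<lambda>x. of_real s * u (t *\<^sub>R x)) k =
    of_real (s / t ^ CARD('n)) * fourier_L1 u ((1 / t) *\<^sub>R k)"
proof -
  let ?h = "\<lambda>y. exp (- (\<i> * complex_of_real (((1 / t) *\<^sub>R k) \<bullet> y))) * u y"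
  have "(LINT x|lebesgue. exp (- (\<i> * complex_of_real (k \<bullet> x))) * (of_real s * u (t *\<^sub>R x))) =
        (LINT x|lebesgue. of_real s * ?h (t *\<^sub>R x))"
    using t by (intro Bochner_Integration.integral_cong) (auto simp: mult_ac)
  also have "\<dots> = of_real s * (LINT x|lebesgue. ?h (t *\<^sub>R x))"
    by simp
  also have "(LINT x|lebesgue. ?h (t *\<^sub>R x)) = (1 / t ^ CARD('n)) *\<^sub>R (LINT x|lebesgue. ?h x)"
    by (rule integral_dilation) (use t in measurable)
  finally show ?thesis
    unfolding fourier_L1_def by (simp add: scaleR_conv_of_real mult_ac)
qed

section \<open>A compactly supported product function with decaying transform\<close>

text \<open>
  Fubini over all coordinates: Lebesgue measure on a Euclidean space is the image of the
  product of one-dimensional Lebesgue measures.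
\<close>

lemma
  fixes f :: "'a::euclidean_space \<Rightarrow> real \<Rightarrow> 'c::{real_normed_field, banach, second_countable_topology}"
  assumes f: "\<And>b. b \<in> Basis \<Longrightarrow> integrable lborel (f b)"
  shows integrable_prod_Basis: "integrable lborel (\<lambda>x::'a. \<Prod>b\<in>Basis. f b (x \<bullet> b))"
    and integral_prod_Basis:
      "(LINT x|lborel. (\<Prod>b\<in>Basis. f b (x \<bullet> b))) = (\<Prod>b\<in>Basis. integral\<^sup>L lborel (f b))"
proof -
  interpret product_sigma_finite "\<lambda>_::'a. lborel :: real measure"
    by standard
  have [measurable]: "b \<in> Basis \<Longrightarrow> f b \<in> borel_measurable borel" for b
    using borel_measurable_integrable[OF f] by simp
  have T[measurable]: "(\<lambda>g. \<Sum>b\<in>Basis. g b *\<^sub>R b) \<in> (\<Pi>\<^sub>M b\<in>Basis. lborel) \<rightarrow>\<^sub>M (borel :: 'a measure)"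
    by measurable
  have P[measurable]: "(\<lambda>x::'a. \<Prod>b\<in>Basis. f b (x \<bullet> b)) \<in> borel_measurable borel"
    by measurable
  have c: "(\<Prod>b\<in>Basis. f b ((\<Sum>c\<in>Basis. g c *\<^sub>R c) \<bullet> b)) = (\<Prod>b\<in>Basis. f b (g b))" for g
    by (intro prod.cong refl) simp
  show "integrable lborel (\<lambda>x::'a. \<Prod>b\<in>Basis. f b (x \<bullet> b))"
    unfolding lborel_eq[where 'a='a] using product_integrable_prod[of Basis f] f
    by (subst integrable_distr_eq[OF T P]) (simp add: c)
  have "(LINT x|lborel. (\<Prod>b\<in>Basis. f b (x \<bullet> b))) =
      (LINT x|distr (\<Pi>\<^sub>M b\<in>Basis. lborel) borel (\<lambda>g. \<Sum>b\<in>Basis. g b *\<^sub>R (b::'a)). (\<Prod>b\<in>Basis. f b (x \<bullet> b)))"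
    unfolding lborel_eq[where 'a='a] ..
  also have "\<dots> = (\<Prod>b\<in>Basis. integral\<^sup>L lborel (f b))"
    using product_integral_prod[of Basis f] f
    by (subst integral_distr[OF T P]) (simp add: c)
  finally show "(LINT x|lborel. (\<Prod>b\<in>Basis. f b (x \<bullet> b))) = (\<Prod>b\<in>Basis. integral\<^sup>L lborel (f b))" .
qed

text \<open>
  The truncated parabola is continuous and vanishes at the end points of its support, which is what
  makes its transform decay quadratically. The indicator of the interval would only give decay of
  order \<open>1 / k\<close>, and its products fail to be in \<open>H^(1/2)\<close>.
\<close>

definition parabola :: "real \<Rightarrow> real" where
  "parabola x = indicator {-1..1} x * (1 - x\<^sup>2)"

lemma borel_measurable_parabola [measurable]: "parabola \<in> borel_measurable borel"
  unfolding parabola_def[abs_def] by measurable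

lemma parabola_bounds: "0 \<le> parabola x" "parabola x \<le> 1" "\<bar>x\<bar> > 1 \<Longrightarrow> parabola x = 0"
proof -
  have "\<bar>x\<bar> \<le> 1 \<Longrightarrow> x\<^sup>2 \<le> 1" by (simp add: abs_square_le_1)
  then show "0 \<le> parabola x" "parabola x \<le> 1" "\<bar>x\<bar> > 1 \<Longrightarrow> parabola x = 0"
    by (auto simp: parabola_def indicator_def)
qed

definition parabola_transform :: "real \<Rightarrow> complex" where
  "parabola_transform k = (LINT x|lborel. exp (- (\<i> * of_real (k * x))) * of_real (parabola x))"

lemma integrable_parabola_transform:
  "integrable lborel (\<lambda>x. exp (- (\<i> * of_real (k * x))) * complex_of_real (parabola x))"
proof (rule Bochner_Integration.integrable_bound)
  show "integrable lborel (indicat_real {-1..1::real})" by (rule integrable_real_indicator) auto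
  show "AE x in lborel. norm (exp (- (\<i> * of_real (k * x))) * complex_of_real (parabola x))
      \<le> norm (indicat_real {-1..1::real} x)"
    using parabola_bounds
    by (intro AE_I2) (auto simp: norm_mult indicator_def not_le abs_le_iff)
qed measurable

lemma norm_parabola_transform_le_2: "norm (parabola_transform k) \<le> 2"
proof -
  have "norm (parabola_transform k) \<le> (LINT x|lborel. indicat_real {-1..1::real} x)"
    unfolding parabola_transform_def
  proof (rule Bochner_Integration.integral_norm_bound_integral[OF integrable_parabola_transform])
    show "norm (exp (- (\<i> * of_real (k * x))) * complex_of_real (parabola x)) \<le> indicat_real {-1..1::real} x" for x
      using parabola_bounds[of x] by (auto simp: norm_mult indicator_def not_le abs_le_iff)
  qed (rule integrable_real_indicator, auto)
  then show ?thesis by simp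
qed

text \<open>
  Repeated integration by parts, written as an explicit antiderivative: no term of order \<open>1 / k\<close> survives
  because \<open>1 - x^2\<close> vanishes at both end points.
\<close>

lemma parabola_transform_eq:
  assumes "k \<noteq> 0"
  shows "parabola_transform k =
    exp (- (\<i> * k)) * (- 2 / k\<^sup>2 + 2 * \<i> / k ^ 3) - exp (\<i> * k) * (2 / k\<^sup>2 + 2 * \<i> / k ^ 3)"
proof -
  \<comment> \<open>The bracket is \<open>i g/k + g'/k^2 - i g''/k^3\<close> for \<open>g = 1 - x^2\<close>.\<close>
  let ?F = "\<lambda>x. exp (- (\<i> * of_real (k * x))) *
    (\<i> * of_real (1 - x\<^sup>2) / of_real k - 2 * of_real x / of_real (k\<^sup>2) + 2 * \<i> / of_real (k ^ 3))"
  let ?f = "\<lambda>x. exp (- (\<i> * of_real (k * x))) * complex_of_real (1 - x\<^sup>2)"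
  have "parabola_transform k = (LINT x|lborel. indicator {-1..1} x *\<^sub>R ?f x)"
    unfolding parabola_transform_def parabola_def
    by (intro Bochner_Integration.integral_cong) (auto simp: indicator_def)
  also have "\<dots> = ?F 1 - ?F (-1)"
  proof (rule integral_FTC_Icc)
    fix x :: real
    have "((\<lambda>z. exp (- (\<i> * (of_real k * z))) *
      (\<i> * (1 - z\<^sup>2) / of_real k - 2 * z / of_real (k\<^sup>2) + 2 * \<i> / of_real (k ^ 3)))
      has_field_derivative ?f x) (at (of_real x))"
      using assms by (auto intro!: derivative_eq_intros simp: field_simps power2_eq_square power3_eq_cube)
    from has_vector_derivative_real_field[OF this]
    show "(?F has_vector_derivative ?f x) (at x within {-1..1})" by simp
  qed (auto intro!: continuous_intros)
  finally show ?thesis by (simp add: algebra_simps)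
qed

text \<open>
  The explicit formula is of size \<open>O(1 / k^2)\<close> away from the origin, where it has a removable
  singularity; near the origin the trivial bound by the length of the support takes over.
\<close>

lemma norm_parabola_transform_le: "norm (parabola_transform k) \<le> 16 / (1 + k\<^sup>2)"
proof (cases "\<bar>k\<bar> \<le> 1")
  case True
  then have "k\<^sup>2 \<le> 1" by (simp add: abs_square_le_1)
  then have "2 \<le> 16 / (1 + k\<^sup>2)" by (subst pos_le_divide_eq) (auto intro: add_pos_nonneg)
  with norm_parabola_transform_le_2[of k] show ?thesis by linarith
next
  case False
  then have k: "\<bar>k\<bar> > 1" "k \<noteq> 0" by auto
  then have k2: "k\<^sup>2 > 1" by (metis one_less_power power2_abs zero_less_numeral)
  have k3: "\<bar>k\<bar> ^ 3 \<ge> k\<^sup>2" using k power_increasing[of 2 3 "\<bar>k\<bar>"] by simp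
  have n1: "norm (- 2 / (complex_of_real k)\<^sup>2 + 2 * \<i> / complex_of_real k ^ 3) \<le> 4 / k\<^sup>2"
  proof -
    have "norm (- 2 / (complex_of_real k)\<^sup>2 + 2 * \<i> / complex_of_real k ^ 3) \<le> 2 / k\<^sup>2 + 2 / \<bar>k\<bar> ^ 3"
      by (rule norm_triangle_le) (simp add: norm_divide norm_mult norm_power)
    also have "2 / \<bar>k\<bar> ^ 3 \<le> 2 / k\<^sup>2" using k3 k by (intro divide_left_mono) auto
    finally show ?thesis by simp
  qed
  have n2: "norm (2 / (complex_of_real k)\<^sup>2 + 2 * \<i> / complex_of_real k ^ 3) \<le> 4 / k\<^sup>2"
  proof -
    have "norm (2 / (complex_of_real k)\<^sup>2 + 2 * \<i> / complex_of_real k ^ 3) \<le> 2 / k\<^sup>2 + 2 / \<bar>k\<bar> ^ 3"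
      by (rule norm_triangle_le) (simp add: norm_divide norm_mult norm_power)
    also have "2 / \<bar>k\<bar> ^ 3 \<le> 2 / k\<^sup>2" using k3 k by (intro divide_left_mono) auto
    finally show ?thesis by simp
  qed
  have "norm (parabola_transform k) \<le> 4 / k\<^sup>2 + 4 / k\<^sup>2"
    unfolding parabola_transform_eq[OF k(2)]
    by (rule norm_triangle_le_diff) (use n1 n2 in \<open>simp add: norm_mult\<close>)
  also have "\<dots> = 16 / (2 * k\<^sup>2)" by simp
  also have "\<dots> \<le> 16 / (1 + k\<^sup>2)" using k2 by (intro divide_left_mono) (auto intro!: mult_pos_pos add_pos_pos simp: k)
  finally show ?thesis .
qed

definition product_bump :: "real^'n \<Rightarrow> complex" where
  "product_bump x = of_real (\<Prod>b\<in>Basis. parabola (x \<bullet> b))"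

lemma borel_measurable_product_bump [measurable]: "product_bump \<in> borel_measurable borel"
  unfolding product_bump_def[abs_def] by measurable

lemma fourier_L1_product_bump:
  fixes k :: "real^'n"
  shows "fourier_L1 product_bump k =
    of_real ((2 * pi) powr (- real CARD('n) / 2)) * (\<Prod>b\<in>Basis. parabola_transform (k \<bullet> b))"
proof -
  have e: "exp (- (\<i> * complex_of_real (k \<bullet> x))) * product_bump x =
    (\<Prod>b\<in>Basis. exp (- (\<i> * of_real ((k \<bullet> b) * (x \<bullet> b)))) * of_real (parabola (x \<bullet> b)))" for x
    unfolding product_bump_def prod.distrib
    by (subst euclidean_inner) (simp add: exp_sum sum_distrib_left flip: sum_negf)
  have "(LINT x|lebesgue. exp (- (\<i> * complex_of_real (k \<bullet> x))) * product_bump x) =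
        (LINT x|lborel. exp (- (\<i> * complex_of_real (k \<bullet> x))) * product_bump x)"
    by (rule integral_lebesgue_borel) measurable
  also have "\<dots> = (\<Prod>b\<in>Basis. parabola_transform (k \<bullet> b))"
    unfolding e parabola_transform_def
    by (rule integral_prod_Basis) (rule integrable_parabola_transform)
  finally show ?thesis unfolding fourier_L1_def by simp
qed

text \<open>
  Used to distribute the non-product weight \<open>1 + |k|\<close> over the coordinates.
\<close>

lemma one_plus_sum_le_prod:
  fixes g :: "'a \<Rightarrow> real"
  assumes "finite A" "\<And>i. i \<in> A \<Longrightarrow> 0 \<le> g i"
  shows "1 + sum g A \<le> (\<Prod>i\<in>A. 1 + g i)"
  using assms
proof (induction A)
  case (insert i A)
  have 1: "1 + sum g A \<le> (\<Prod>j\<in>A. 1 + g j)" by (rule insert.IH) (use insert.prems in simp)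
  have 2: "0 \<le> sum g A" by (rule sum_nonneg) (use insert.prems in simp)
  have "1 + sum g (insert i A) \<le> (1 + g i) * (1 + sum g A)"
    using insert.hyps mult_nonneg_nonneg[OF insert.prems[of i] 2] by (simp add: algebra_simps)
  also have "\<dots> \<le> (1 + g i) * (\<Prod>j\<in>A. 1 + g j)"
    using 1 insert.prems[of i] by (intro mult_left_mono) auto
  also have "\<dots> = (\<Prod>j\<in>insert i A. 1 + g j)"
    using insert.hyps by simp
  finally show ?case .
qed simp

text \<open>
  Since \<open>1 + |k|\<close> is at most the product of the \<open>1 + |k\<^sub>b|\<close>, the integrand is dominated by a
  product of functions of one coordinate each, every one of size \<open>O(1 / (1 + k\<^sub>b^2))\<close>.
\<close>

lemma integrable_fourier_product_bump:
  "integrable lebesgue (\<lambda>k::real^'n. (1 + norm k) * (norm (fourier_L1 product_bump k))\<^sup>2)"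
proof -
  define C where "C = ((2 * pi) powr (- real CARD('n) / 2))\<^sup>2"
  have C: "C \<ge> 0" unfolding C_def by simp
  have int1: "integrable lborel (\<lambda>x::real. inverse (1 + x\<^sup>2))"
    using integrable_inverse_1_plus_square by (simp add: set_integrable_def)
  have 1: "(1 + \<bar>y\<bar>) * (norm (parabola_transform y))\<^sup>2 \<le> 512 * inverse (1 + y\<^sup>2)" for y
  proof -
    have pos: "1 + y\<^sup>2 > 0" by (simp add: add_pos_nonneg)
    have "(norm (parabola_transform y))\<^sup>2 \<le> (16 / (1 + y\<^sup>2))\<^sup>2"
      using norm_parabola_transform_le by (intro power_mono) auto
    moreover have "1 + \<bar>y\<bar> \<le> 2 * (1 + y\<^sup>2)"
    proof -
      have "0 \<le> (\<bar>y\<bar> - 1)\<^sup>2" by simp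
      then have "2 * \<bar>y\<bar> \<le> 1 + y\<^sup>2" by (simp add: power2_diff)
      then show ?thesis using zero_le_power2[of y] unfolding distrib_left by linarith
    qed
    ultimately have "(1 + \<bar>y\<bar>) * (norm (parabola_transform y))\<^sup>2 \<le> (2 * (1 + y\<^sup>2)) * (16 / (1 + y\<^sup>2))\<^sup>2"
      by (intro mult_mono) auto
    also have "\<dots> = 512 * inverse (1 + y\<^sup>2)"
    proof -
      have "(2 * z) * (16 / z)\<^sup>2 = 512 * inverse z" if "z > 0" for z :: real
        using that by (simp add: field_simps power2_eq_square)
      from this[OF pos] show ?thesis .
    qed
    finally show ?thesis .
  qed
  have [measurable]: "fourier_L1 product_bump \<in> borel_measurable borel"
    by (rule borel_measurable_fourier_L1) measurable
  have "integrable lborel (\<lambda>k::real^'n. C * (\<Prod>b\<in>Basis. 512 * inverse (1 + (k \<bullet> b)\<^sup>2)))"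
    using int1 by (intro integrable_mult_right integrable_prod_Basis[where f="\<lambda>_ x. 512 * inverse (1 + x\<^sup>2)"]) auto
  then have "integrable lborel (\<lambda>k::real^'n. (1 + norm k) * (norm (fourier_L1 product_bump k))\<^sup>2)"
  proof (rule Bochner_Integration.integrable_bound)
    show "AE k in lborel. norm ((1 + norm (k::real^'n)) * (norm (fourier_L1 product_bump k))\<^sup>2)
       \<le> norm (C * (\<Prod>b\<in>Basis. 512 * inverse (1 + (k \<bullet> b)\<^sup>2)))"
    proof (intro AE_I2)
      fix k :: "real^'n"
      have "1 + norm k \<le> 1 + (\<Sum>b\<in>Basis. \<bar>k \<bullet> b\<bar>)" using norm_le_l1[of k] by simp
      also have "\<dots> \<le> (\<Prod>b\<in>Basis. 1 + \<bar>k \<bullet> b\<bar>)" by (rule one_plus_sum_le_prod) auto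
      finally have a: "1 + norm k \<le> (\<Prod>b\<in>Basis. 1 + \<bar>k \<bullet> b\<bar>)" .
      have "(1 + norm k) * (norm (fourier_L1 product_bump k))\<^sup>2
        = C * ((1 + norm k) * (\<Prod>b\<in>Basis. (norm (parabola_transform (k \<bullet> b)))\<^sup>2))"
        unfolding fourier_L1_product_bump C_def
        by (simp add: norm_mult power_mult_distrib prod_norm[symmetric] prod_power_distrib)
      also have "\<dots> \<le> C * ((\<Prod>b\<in>Basis. 1 + \<bar>k \<bullet> b\<bar>) * (\<Prod>b\<in>Basis. (norm (parabola_transform (k \<bullet> b)))\<^sup>2))"
        using a C by (intro mult_left_mono mult_right_mono prod_nonneg) auto
      also have "\<dots> = C * (\<Prod>b\<in>Basis. (1 + \<bar>k \<bullet> b\<bar>) * (norm (parabola_transform (k \<bullet> b)))\<^sup>2)"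
        by (simp add: prod.distrib)
      also have "\<dots> \<le> C * (\<Prod>b\<in>Basis. 512 * inverse (1 + (k \<bullet> b)\<^sup>2))"
        using 1 C by (intro mult_left_mono prod_mono) auto
      finally show "norm ((1 + norm k) * (norm (fourier_L1 product_bump k))\<^sup>2)
       \<le> norm (C * (\<Prod>b\<in>Basis. 512 * inverse (1 + (k \<bullet> b)\<^sup>2)))"
        by simp
    qed
  qed measurable
  then show ?thesis by (subst integrable_lebesgue_borel) measurable
qed

section \<open>Bounded functions of compact support and their energy\<close>

lemma abs_mult_ln_le:
  fixes x :: real assumes "x \<ge> 0" shows "\<bar>x * ln x\<bar> \<le> 1 + x\<^sup>2"
proof (cases "x = 0")
  case False
  with assms have x: "x > 0" by simp
  have "ln x \<le> x - 1" using x by (rule ln_le_minus_one)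
  then have 1: "x * ln x \<le> x * (x - 1)" using x by (intro mult_left_mono) auto
  have "ln (1 / x) \<le> 1 / x - 1" using x by (intro ln_le_minus_one) simp
  then have "x * (- ln x) \<le> x * (1 / x - 1)" using x by (intro mult_left_mono) (auto simp: ln_div)
  then have 2: "- (x * ln x) \<le> 1 - x" using x by (simp add: algebra_simps)
  from 1 2 x zero_le_square[of x] show ?thesis
    unfolding power2_eq_square right_diff_distrib by linarith
qed simp

text \<open>
  The functions that are dilated. The support condition makes the Fourier transform an ordinary
  integral, the last condition puts the function into \<open>H^(1/2)\<close>, and the class is stable
  under the rescalings used below (\<open>rescaled_profile\<close>).
\<close>

locale profile =
  fixes u :: "real^'n \<Rightarrow> complex" and R B :: real
  assumes measurable_u [measurable]: "u \<in> borel_measurable borel"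
    and bounded: "norm (u x) \<le> B"
    and support: "R < norm x \<Longrightarrow> u x = 0"
    and integrable_transform: "integrable lebesgue (\<lambda>k. (1 + norm k) * (norm (fourier_L1 u k))\<^sup>2)"
begin

lemma B_nonneg: "0 \<le> B"
  using bounded[of 0] norm_ge_zero order_trans by blast

text \<open>
  One domination argument for the mass, the p-norm and the entropy: each integrand is a function
  of \<open>|u|\<close> that vanishes at 0 and is bounded on the range of \<open>|u|\<close>, hence it is dominated by a
  multiple of the indicator of a ball.
\<close>

lemma integrable_of_norm:
  fixes g :: "real \<Rightarrow> real"
  assumes [measurable]: "g \<in> borel_measurable borel"
    and C: "\<And>r. 0 \<le> r \<Longrightarrow> r \<le> B \<Longrightarrow> \<bar>g r\<bar> \<le> C" and g0: "g 0 = 0"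
  shows "integrable lebesgue (\<lambda>x. g (norm (u x)))"
proof -
  have "integrable lborel (\<lambda>x. C * indicat_real (cball (0::real^'n) R) x)"
    by (intro integrable_mult_right integrable_real_indicator) (use emeasure_lborel_cball_finite[of "0::real^'n" R] in simp_all)
  then have "integrable lborel (\<lambda>x. g (norm (u x)))"
  proof (rule Bochner_Integration.integrable_bound)
    show "AE x in lborel. norm (g (norm (u x))) \<le> norm (C * indicat_real (cball (0::real^'n) R) x)"
    proof (intro AE_I2)
      fix x :: "real^'n"
      show "norm (g (norm (u x))) \<le> norm (C * indicat_real (cball (0::real^'n) R) x)"
        using C[of "norm (u x)"] bounded[of x] support[of x] g0
        by (cases "norm x \<le> R") (auto simp: indicator_def)
    qed
  qed measurable
  then show ?thesis by (subst integrable_lebesgue_borel) measurable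
qed

lemma integrable_powr: "q > 0 \<Longrightarrow> integrable lebesgue (\<lambda>x. norm (u x) powr q)"
  by (rule integrable_of_norm[of "\<lambda>r. r powr q" "B powr q"]) (auto intro: powr_mono2)

lemma integrable_square: "integrable lebesgue (\<lambda>x. (norm (u x))\<^sup>2)"
  by (rule integrable_of_norm[of "\<lambda>r. r\<^sup>2" "B\<^sup>2"]) (auto intro: power_mono)

lemma integrable_entropy: "integrable lebesgue (\<lambda>x. (norm (u x))\<^sup>2 * ln ((norm (u x))\<^sup>2))"
proof (rule integrable_of_norm[of "\<lambda>r. r\<^sup>2 * ln (r\<^sup>2)" "1 + (B\<^sup>2)\<^sup>2"])
  fix r :: real assume "0 \<le> r" "r \<le> B"
  then have "(r\<^sup>2)\<^sup>2 \<le> (B\<^sup>2)\<^sup>2" by (intro power_mono) auto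
  with abs_mult_ln_le[of "r\<^sup>2"] show "\<bar>r\<^sup>2 * ln (r\<^sup>2)\<bar> \<le> 1 + (B\<^sup>2)\<^sup>2" by simp
qed auto

lemma measurable_transform [measurable]: "fourier_L1 u \<in> borel_measurable borel"
  by (rule borel_measurable_fourier_L1) (rule measurable_u)

lemma integrable_norm_transform: "integrable lebesgue (\<lambda>k. norm k * (norm (fourier_L1 u k))\<^sup>2)"
  by (rule Bochner_Integration.integrable_bound[OF integrable_transform])
    (auto intro!: AE_I2 borel_imp_lebesgue_measurable mult_right_mono)

lemma transform_in_L2: "fourier_L1 u \<in> Lspace 2"
  unfolding Lspace_def
proof (safe intro!: borel_imp_lebesgue_measurable measurable_transform)
  show "integrable lebesgue (\<lambda>k. norm (fourier_L1 u k) powr 2)"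
  proof (rule Bochner_Integration.integrable_bound[OF integrable_transform])
    show "AE k in lebesgue. norm (norm (fourier_L1 u k) powr 2) \<le> norm ((1 + norm k) * (norm (fourier_L1 u k))\<^sup>2)"
      by (intro AE_I2) (auto simp: algebra_simps)
  qed (auto intro!: borel_imp_lebesgue_measurable)
qed

lemma truncation_eventually_trivial:
  "\<forall>\<^sub>F n in sequentially. (\<lambda>x. indicator (cball 0 (real n)) x * u x) = u"
proof -
  obtain n0 :: nat where n0: "R \<le> real n0" using real_arch_simple by blast
  have "(\<lambda>x. indicator (cball 0 (real n)) x * u x) = u" if "n \<ge> n0" for n
  proof
    fix x show "indicator (cball 0 (real n)) x * u x = u x"
      using that n0 support[of x] by (cases "norm x \<le> real n") (auto simp: indicator_def)
  qed
  then show ?thesis unfolding eventually_sequentially by blast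
qed

text \<open>
  The sequence whose limit defines the transform is eventually constant, so the limit condition says
  that the distance of \<open>g\<close> from the Fourier integral is zero.
\<close>

lemma is_fourier_L2_iff:
  "is_fourier_L2 u g \<longleftrightarrow> g \<in> Lspace 2 \<and> (AE k in lebesgue. g k = fourier_L1 u k)"
proof -
  let ?I = "\<lambda>w. \<integral>\<^sup>+ k. ennreal ((norm (fourier_L1 w k - g k))\<^sup>2) \<partial>lebesgue"
  have ev: "\<forall>\<^sub>F n in sequentially. ?I (\<lambda>x. indicator (cball 0 (real n)) x * u x) = ?I u"
    using truncation_eventually_trivial by eventually_elim simp
  have "(\<lambda>n. ?I (\<lambda>x. indicator (cball 0 (real n)) x * u x)) \<longlonglongrightarrow> 0 \<longleftrightarrow> (\<lambda>n::nat. ?I u) \<longlonglongrightarrow> 0"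
    by (rule tendsto_cong[OF ev])
  also have "\<dots> \<longleftrightarrow> ?I u = 0" by (simp add: LIMSEQ_const_iff)
  finally have lim: "(\<lambda>n. ?I (\<lambda>x. indicator (cball 0 (real n)) x * u x)) \<longlonglongrightarrow> 0 \<longleftrightarrow> ?I u = 0" .
  have "?I u = 0 \<longleftrightarrow> (AE k in lebesgue. g k = fourier_L1 u k)" if "g \<in> Lspace 2"
  proof -
    have [measurable]: "g \<in> borel_measurable lebesgue" using that by (simp add: Lspace_def)
    have [measurable]: "fourier_L1 u \<in> borel_measurable lebesgue"
      by (rule borel_imp_lebesgue_measurable[OF measurable_transform])
    have "?I u = 0 \<longleftrightarrow> (AE k in lebesgue. ennreal ((norm (fourier_L1 u k - g k))\<^sup>2) = 0)"
      by (rule nn_integral_0_iff_AE) measurable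
    also have "\<dots> \<longleftrightarrow> (AE k in lebesgue. g k = fourier_L1 u k)"
      by (intro AE_cong) (auto simp: ennreal_eq_0_iff)
    finally show ?thesis .
  qed
  with lim show ?thesis unfolding is_fourier_L2_def by blast
qed

lemma fourier_eq: "fourier u \<in> Lspace 2" "AE k in lebesgue. fourier u k = fourier_L1 u k"
proof -
  have "is_fourier_L2 u (fourier u)"
    unfolding fourier_def by (rule someI[of _ "fourier_L1 u"]) (simp add: is_fourier_L2_iff transform_in_L2)
  then show "fourier u \<in> Lspace 2" "AE k in lebesgue. fourier u k = fourier_L1 u k"
    by (simp_all add: is_fourier_L2_iff)
qed

lemma measurable_fourier [measurable]: "fourier u \<in> borel_measurable lebesgue"
  using fourier_eq(1) by (simp add: Lspace_def)

lemma in_W_half: "u \<in> W_half"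
proof -
  have "u \<in> Lspace 2"
    unfolding Lspace_def using integrable_powr[of 2] by (auto intro: borel_imp_lebesgue_measurable)
  moreover have "integrable lebesgue (\<lambda>k. sqrt (1 + (norm k)\<^sup>2) * (norm (fourier u k))\<^sup>2)"
  proof (rule Bochner_Integration.integrable_bound[OF integrable_transform])
    show "AE k in lebesgue. norm (sqrt (1 + (norm k)\<^sup>2) * (norm (fourier u k))\<^sup>2)
        \<le> norm ((1 + norm k) * (norm (fourier_L1 u k))\<^sup>2)"
      using fourier_eq(2)
    proof eventually_elim
      case (elim k)
      have "sqrt (1 + (norm k)\<^sup>2) \<le> 1 + norm k"
        by (rule real_le_lsqrt) (auto simp: power2_eq_square algebra_simps)
      then show ?case using elim by (auto intro!: mult_right_mono)
    qed
    have [measurable]: "(\<lambda>k::real^'n. sqrt (1 + (norm k)\<^sup>2)) \<in> borel_measurable lebesgue"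
      by (rule borel_imp_lebesgue_measurable) measurable
    show "(\<lambda>k. sqrt (1 + (norm k)\<^sup>2) * (norm (fourier u k))\<^sup>2) \<in> borel_measurable lebesgue"
      by measurable
  qed
  ultimately show ?thesis
    using integrable_entropy by (simp add: W_half_def H_half_def)
qed

lemma Lnorm_2_squared: "(Lnorm 2 u)\<^sup>2 = (LINT x|lebesgue. (norm (u x))\<^sup>2)"
  unfolding Lnorm_def by (simp add: powr_half_sqrt)

lemma Lnorm_powr: "q > 0 \<Longrightarrow> Lnorm q u powr q = (LINT x|lebesgue. norm (u x) powr q)"
  unfolding Lnorm_def by (simp add: powr_powr)

text \<open>
  Both \<open>sqrt(|k|^2 + m^2) - m\<close> and \<open>|v \<bullet> k|\<close> lie between 0 and \<open>|k|\<close>. Replacing the symbol by a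
  multiple of \<open>|k|\<close> makes the bound exactly homogeneous under dilations.
\<close>

lemma kinetic_le:
  assumes "m \<ge> 0" "norm v \<le> 1"
  shows "kinetic m v u \<le> 2 * (LINT k|lebesgue. norm k * (norm (fourier_L1 u k))\<^sup>2)"
proof -
  let ?s = "\<lambda>k. sqrt ((norm k)\<^sup>2 + m\<^sup>2) - m - v \<bullet> k"
  have s: "\<bar>?s k\<bar> \<le> 2 * norm k" for k :: "real^'n"
  proof -
    have "sqrt ((norm k)\<^sup>2 + m\<^sup>2) \<le> norm k + m"
      using assms(1) by (intro real_le_lsqrt) (auto simp: power2_eq_square algebra_simps)
    moreover have "m \<le> sqrt ((norm k)\<^sup>2 + m\<^sup>2)" by (rule real_le_rsqrt) simp
    moreover have "\<bar>v \<bullet> k\<bar> \<le> norm k"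
      using Cauchy_Schwarz_ineq2[of v k] mult_right_mono[OF assms(2), of "norm k"] by simp
    ultimately show ?thesis using norm_ge_zero[of k] by linarith
  qed
  have ae: "AE k in lebesgue. \<bar>?s k * (norm (fourier u k))\<^sup>2\<bar> \<le> 2 * (norm k * (norm (fourier_L1 u k))\<^sup>2)"
    using fourier_eq(2)
  proof eventually_elim
    case (elim k)
    have "\<bar>?s k\<bar> * (norm (fourier_L1 u k))\<^sup>2 \<le> 2 * norm k * (norm (fourier_L1 u k))\<^sup>2"
      using s by (intro mult_right_mono) auto
    with elim show ?case by (simp add: abs_mult mult.assoc)
  qed
  have int2: "integrable lebesgue (\<lambda>k. 2 * (norm k * (norm (fourier_L1 u k))\<^sup>2))"
    using integrable_norm_transform by simp
  have [measurable]: "?s \<in> borel_measurable lebesgue"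
    by (rule borel_imp_lebesgue_measurable) measurable
  have int1: "integrable lebesgue (\<lambda>k. ?s k * (norm (fourier u k))\<^sup>2)"
    using ae by (intro Bochner_Integration.integrable_bound[OF int2]) auto
  have "kinetic m v u \<le> (LINT k|lebesgue. 2 * (norm k * (norm (fourier_L1 u k))\<^sup>2))"
    unfolding kinetic_def using ae by (intro integral_mono_AE[OF int1 int2]) auto
  then show ?thesis by simp
qed

lemma energy_le:
  assumes "m \<ge> 0" "norm v \<le> 1" "p > 0"
  shows "energy m v p u \<le> (LINT k|lebesgue. norm k * (norm (fourier_L1 u k))\<^sup>2)
      - (LINT x|lebesgue. norm (u x) powr p) / p
      - (LINT x|lebesgue. (norm (u x))\<^sup>2 * (ln ((norm (u x))\<^sup>2) - 1)) / 2"
  using kinetic_le[OF assms(1,2)] unfolding energy_def Lnorm_powr[OF assms(3)] by simp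

text \<open>
  Only \<open>t \<ge> 1\<close> is allowed, so that the support stays in the same ball.
\<close>

lemma rescaled_profile:
  assumes "t \<ge> 1" "s \<ge> 0"
  shows "profile (\<lambda>x. of_real s * u (t *\<^sub>R x)) R (s * B)"
proof
  show "(\<lambda>x. of_real s * u (t *\<^sub>R x)) \<in> borel_measurable borel" by measurable
  show "norm (of_real s * u (t *\<^sub>R x)) \<le> s * B" for x
    using bounded assms by (simp add: norm_mult mult_left_mono)
  show "of_real s * u (t *\<^sub>R x) = 0" if "R < norm x" for x
  proof -
    have "norm x \<le> t * norm x" using assms mult_right_mono[of 1 t "norm x"] by simp
    then show ?thesis using that support[of "t *\<^sub>R x"] assms by simp
  qed
  let ?h = "\<lambda>k. (1 + t * norm k) * (norm (fourier_L1 u k))\<^sup>2"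
  have "integrable lebesgue (\<lambda>k. (norm (fourier_L1 u k))\<^sup>2)"
    using transform_in_L2 by (simp add: Lspace_def)
  then have "integrable lebesgue ?h"
    using integrable_norm_transform by (simp add: ring_distribs mult.assoc)
  moreover have "?h \<in> borel_measurable borel" by measurable
  ultimately have "integrable lebesgue (\<lambda>k. ?h ((1 / t) *\<^sub>R k))"
    using integrable_dilation[of ?h "1 / t"] assms by simp
  then have "integrable lebesgue (\<lambda>k. (s / t ^ CARD('n))\<^sup>2 * ?h ((1 / t) *\<^sub>R k))"
    by (rule integrable_mult_right)
  then show "integrable lebesgue (\<lambda>k. (1 + norm k) * (norm (fourier_L1 (\<lambda>x. of_real s * u (t *\<^sub>R x)) k))\<^sup>2)"
    using assms by (subst fourier_L1_dilation)
      (auto simp: norm_mult norm_divide norm_power power_mult_distrib power_divide mult_ac)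
qed

lemma rescaled_momentum:
  assumes "t > 0"
  shows "(LINT k|lebesgue. norm k * (norm (fourier_L1 (\<lambda>x. of_real s * u (t *\<^sub>R x)) k))\<^sup>2) =
    s\<^sup>2 / t ^ CARD('n) * t * (LINT k|lebesgue. norm k * (norm (fourier_L1 u k))\<^sup>2)"
proof -
  let ?h = "\<lambda>k. norm k * (norm (fourier_L1 u k))\<^sup>2"
  have "(LINT k|lebesgue. norm k * (norm (fourier_L1 (\<lambda>x. of_real s * u (t *\<^sub>R x)) k))\<^sup>2)
      = (LINT k|lebesgue. ((s / t ^ CARD('n))\<^sup>2 * t) * ?h ((1 / t) *\<^sub>R k))"
    using assms by (subst fourier_L1_dilation)
      (auto simp: norm_mult norm_divide norm_power power_mult_distrib power_divide mult_ac)
  also have "\<dots> = ((s / t ^ CARD('n))\<^sup>2 * t) * (LINT k|lebesgue. ?h ((1 / t) *\<^sub>R k))"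
    by simp
  also have "(LINT k|lebesgue. ?h ((1 / t) *\<^sub>R k)) = (1 / (1 / t) ^ CARD('n)) *\<^sub>R (LINT k|lebesgue. ?h k)"
    using assms by (intro integral_dilation) auto
  finally show ?thesis using assms by (simp add: power_divide power2_eq_square)
qed

lemma rescaled_mass:
  assumes "t > 0"
  shows "(LINT x|lebesgue. (norm (of_real s * u (t *\<^sub>R x)))\<^sup>2) =
    s\<^sup>2 / t ^ CARD('n) * (LINT x|lebesgue. (norm (u x))\<^sup>2)"
  using integral_dilation[of "\<lambda>x. (norm (u x))\<^sup>2" t] assms
  by (simp add: norm_mult power_mult_distrib)

lemma rescaled_powr:
  assumes "t > 0" "s \<ge> 0"
  shows "(LINT x|lebesgue. norm (of_real s * u (t *\<^sub>R x)) powr q) =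
    s powr q / t ^ CARD('n) * (LINT x|lebesgue. norm (u x) powr q)"
  using integral_dilation[of "\<lambda>x. norm (u x) powr q" t] assms
  by (simp add: norm_mult powr_mult)

text \<open>
  The logarithm turns the amplitude \<open>s\<close> into an additive multiple of the mass. Where \<open>u\<close>
  vanishes both sides do, in spite of the value of the logarithm at 0.
\<close>

lemma rescaled_entropy:
  assumes "t > 0" "s > 0"
  shows "(LINT x|lebesgue. (norm (of_real s * u (t *\<^sub>R x)))\<^sup>2 * (ln ((norm (of_real s * u (t *\<^sub>R x)))\<^sup>2) - 1)) =
    s\<^sup>2 / t ^ CARD('n) * (ln (s\<^sup>2) * (LINT x|lebesgue. (norm (u x))\<^sup>2) +
      (LINT x|lebesgue. (norm (u x))\<^sup>2 * (ln ((norm (u x))\<^sup>2) - 1)))"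
proof -
  let ?h = "\<lambda>x. ln (s\<^sup>2) * (norm (u x))\<^sup>2 + (norm (u x))\<^sup>2 * (ln ((norm (u x))\<^sup>2) - 1)"
  have e: "(norm (of_real s * u (t *\<^sub>R x)))\<^sup>2 * (ln ((norm (of_real s * u (t *\<^sub>R x)))\<^sup>2) - 1)
      = s\<^sup>2 * ?h (t *\<^sub>R x)" for x
    using assms
    by (cases "u (t *\<^sub>R x) = 0") (auto simp: norm_mult power_mult_distrib ln_mult algebra_simps)
  have "(LINT x|lebesgue. s\<^sup>2 * ?h (t *\<^sub>R x)) = s\<^sup>2 * (LINT x|lebesgue. ?h (t *\<^sub>R x))"
    by (rule integral_mult_right_zero)
  also have "(LINT x|lebesgue. ?h (t *\<^sub>R x)) = (1 / t ^ CARD('n)) *\<^sub>R (LINT x|lebesgue. ?h x)"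
    using assms by (intro integral_dilation) auto
  also have "(LINT x|lebesgue. ?h x) = ln (s\<^sup>2) * (LINT x|lebesgue. (norm (u x))\<^sup>2) +
      (LINT x|lebesgue. (norm (u x))\<^sup>2 * (ln ((norm (u x))\<^sup>2) - 1))"
    using integrable_square integrable_entropy
    by (subst Bochner_Integration.integral_add) (auto simp: right_diff_distrib)
  finally show ?thesis unfolding e by simp
qed

end

section \<open>The energy is unbounded below on the mass sphere\<close>

lemma product_bump_profile: "profile (product_bump :: real^'n \<Rightarrow> complex) (sqrt (real CARD('n))) 1"
proof
  show "norm (product_bump x) \<le> 1" for x :: "real^'n"
    unfolding product_bump_def norm_of_real using parabola_bounds(1,2)
    by (simp add: abs_prod prod_le_1)
  show "product_bump x = 0" if "sqrt (real CARD('n)) < norm x" for x :: "real^'n"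
  proof -
    \<comment> \<open>The cube \<open>[-1, 1]^N\<close> lies in the ball of radius \<open>sqrt N\<close>.\<close>
    have "\<exists>b\<in>Basis. \<bar>x \<bullet> b\<bar> > 1"
    proof (rule ccontr)
      assume "\<not> ?thesis"
      then have "(x \<bullet> b)\<^sup>2 \<le> 1" if "b \<in> Basis" for b
        using that by (auto simp: abs_square_le_1 not_less)
      then have "(\<Sum>b\<in>Basis. (x \<bullet> b)\<^sup>2) \<le> real (card (Basis :: (real^'n) set)) * 1"
        by (intro sum_bounded_above) 
      then have "norm x \<le> sqrt (real CARD('n))"
        by (simp add: norm_eq_sqrt_inner euclidean_inner[of x x] power2_eq_square)
      with that show False by simp
    qed
    then show ?thesis
      unfolding product_bump_def using parabola_bounds(3) by (auto simp: prod_zero_iff)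
  qed
qed (auto intro: integrable_fourier_product_bump)

lemma product_bump_nonzero: "\<not> (AE x in lebesgue. product_bump (x :: real^'n) = 0)"
proof
  assume "AE x in lebesgue. product_bump (x :: real^'n) = 0"
  then have "negligible {x :: real^'n. product_bump x \<noteq> 0}"
    by (simp add: AE_iff_null_sets negligible_iff_null_sets eventually_ae_filter)
  moreover have "ball 0 1 \<subseteq> {x :: real^'n. product_bump x \<noteq> 0}"
  proof safe
    fix x :: "real^'n" assume x: "x \<in> ball 0 1" "product_bump x = 0"
    then obtain b where b: "b \<in> Basis" "parabola (x \<bullet> b) = 0"
      by (auto simp: product_bump_def prod_zero_iff)
    have "\<bar>x \<bullet> b\<bar> < 1" using Basis_le_norm[OF b(1), of x] x by simp
    then have "(x \<bullet> b)\<^sup>2 < 1" by (simp add: abs_square_less_1)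
    with b \<open>\<bar>x \<bullet> b\<bar> < 1\<close> show False by (auto simp: parabola_def indicator_def abs_less_iff)
  qed
  ultimately have "negligible (ball (0::real^'n) 1)" by (rule negligible_subset)
  then show False using open_not_negligible[of "ball (0::real^'n) 1"] by simp
qed

text \<open>
  The bump is concentrated by the factor \<open>t\<close>, with the amplitude \<open>s\<close> chosen to keep the mass equal to
  \<open>a\<close>. This gives the upper bound \<open>A t + C - D t^\<beta> - a N (ln t) / 2\<close> for the energy,
  where \<open>D > 0\<close> and \<open>\<beta> = N (p - 2) / 2 > 1\<close>.
\<close>

lemma energy_unbounded_below:
  fixes v :: "real^'n"
  assumes "norm v \<le> 1" "m \<ge> 0" "a > 0" and p: "2 + 2 / real CARD('n) < p"
  shows "\<exists>w\<in>mass_sphere a. energy m v p w < c"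
proof -
  interpret profile "product_bump :: real^'n \<Rightarrow> complex" "sqrt (real CARD('n))" 1
    by (rule product_bump_profile)
  let ?u = "product_bump :: real^'n \<Rightarrow> complex"
  let ?N = "real CARD('n)"
  define M where "M = (LINT x|lebesgue. (norm (?u x))\<^sup>2)"
  define P where "P = (LINT x|lebesgue. norm (?u x) powr p)"
  define K where "K = (LINT k|lebesgue. norm k * (norm (fourier_L1 ?u k))\<^sup>2)"
  define L where "L = (LINT x|lebesgue. (norm (?u x))\<^sup>2 * (ln ((norm (?u x))\<^sup>2) - 1))"
  have N: "?N > 0" by simp
  have p2: "p > 2" using p N by (smt (verit) divide_pos_pos)
  have "M \<noteq> 0" "P \<noteq> 0"
    unfolding M_def P_def
    using product_bump_nonzero[where 'n='n] integrable_square integrable_powr[of p] p2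
    by (subst integral_nonneg_eq_0_iff_AE; simp)+
  moreover have "M \<ge> 0" "P \<ge> 0" unfolding M_def P_def by (auto intro: integral_nonneg_AE)
  ultimately have M: "M > 0" and P: "P > 0" by auto
  \<comment> \<open>The factor that normalizes the mass \<open>M\<close> of the bump to \<open>a\<close>.\<close>
  define \<alpha> where "\<alpha> = a / M"
  have \<alpha>: "\<alpha> > 0" using M \<open>a > 0\<close> by (simp add: \<alpha>_def)
  define \<beta> where "\<beta> = ?N * (p - 2) / 2"
  have \<beta>: "\<beta> > 1" using p N by (simp add: \<beta>_def field_simps)
  define D where "D = \<alpha> powr (p / 2) * P / p"
  have D: "D > 0" using \<alpha> P p2 by (simp add: D_def)
  define E where "E = (\<lambda>t. \<alpha> * K * t - D * t powr \<beta> - \<alpha> * ((ln \<alpha> + ?N * ln t) * M + L) / 2)"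
  have *: "\<exists>w\<in>mass_sphere a. energy m v p w \<le> E t" if t: "t \<ge> 1" for t
  proof
    define s where "s = sqrt (\<alpha> * t ^ CARD('n))"
    have tN: "t ^ CARD('n) > 0" using t by simp
    have s: "s > 0" "s\<^sup>2 = \<alpha> * t ^ CARD('n)" using \<alpha> tN by (auto simp: s_def)
    have s\<alpha>: "s\<^sup>2 / t ^ CARD('n) = \<alpha>" using s(2) t by simp
    have lns: "ln (s\<^sup>2) = ln \<alpha> + ?N * ln t"
      using \<alpha> tN t by (simp add: s(2) ln_mult ln_realpow)
    have sp: "s powr p / t ^ CARD('n) = \<alpha> powr (p / 2) * t powr \<beta>"
    proof -
      have tp: "t ^ CARD('n) = t powr ?N" using t by (simp add: powr_realpow)
      have "s = (\<alpha> * t powr ?N) powr (1/2)"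
        using \<alpha> tN by (simp add: s_def powr_half_sqrt tp)
      then have "s powr p = \<alpha> powr (p / 2) * t powr (?N * p / 2)"
        using \<alpha> by (simp add: powr_powr powr_mult)
      moreover have "t powr (?N * p / 2) / t powr ?N = t powr \<beta>"
        by (simp add: powr_diff[symmetric] \<beta>_def field_simps)
      ultimately show ?thesis by (simp add: tp flip: times_divide_eq_right)
    qed
    define w where "w = (\<lambda>x. of_real s * ?u (t *\<^sub>R x))"
    interpret w: profile w "sqrt (real CARD('n))" "s * 1"
      unfolding w_def using t s by (intro rescaled_profile) auto
    have "(Lnorm 2 w)\<^sup>2 = a"
      unfolding w.Lnorm_2_squared unfolding w_def
      using t M by (subst rescaled_mass) (auto simp: s\<alpha> M_def[symmetric] \<alpha>_def)
    then show "w \<in> mass_sphere a" using w.in_W_half by (simp add: mass_sphere_def)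
    have "energy m v p w \<le> \<alpha> * t * K - \<alpha> powr (p / 2) * t powr \<beta> * P / p
        - \<alpha> * ((ln \<alpha> + ?N * ln t) * M + L) / 2"
      using w.energy_le[of m v p] assms p2 t s
      unfolding w_def
      by (simp add: rescaled_momentum rescaled_powr rescaled_entropy s\<alpha> lns[unfolded s(2)] lns sp flip: M_def P_def K_def L_def del: ln_powr)
    then show "energy m v p w \<le> E t" by (simp add: E_def D_def mult_ac)
  qed
  have "filterlim E at_bot at_top"
    unfolding E_def using D \<beta> by real_asymp
  then have "\<forall>\<^sub>F t in at_top. E t < c" by (simp add: filterlim_at_bot_dense)
  with eventually_ge_at_top[of 1] have "\<forall>\<^sub>F t in at_top. t \<ge> 1 \<and> E t < c"
    by eventually_elim simp
  then have "\<exists>t. t \<ge> 1 \<and> E t < c"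
    by (rule eventually_happens'[rotated]) (rule trivial_limit_at_top_linorder)
  then obtain t where "t \<ge> 1" "E t < c" by blast
  with * show ?thesis by (meson le_less_trans)
qed

theorem theorem1p3:
  fixes v :: "real^'n" and m a p :: real
  assumes "CARD('n) \<ge> 2"
    and "norm v < 1"
    and "m > 0" and "a > 0"
    and "2 + 2 / real CARD('n) < p"
    and "p \<le> 2 * real CARD('n) / (real CARD('n) - 1)"
  shows "\<not> (\<exists>u. is_minimizer m v p a u)"
proof
  assume "\<exists>u. is_minimizer m v p a u"
  then obtain u where u: "ereal (energy m v p u) = d_inf m v p a"
    by (auto simp: is_minimizer_def)
  obtain w where w: "w \<in> mass_sphere a" "energy m v p w < energy m v p u"
    using energy_unbounded_below[of v m a p] assms by auto
  have "d_inf m v p a \<le> ereal (energy m v p w)"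
    unfolding d_inf_def using w(1) by (rule INF_lower)
  with u w(2) show False by (metis ereal_less_eq(3) not_le)
qed

end
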